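(* For every $p>0$ the functions $$x\mapsto \frac{xF\left(\frac{1}{p},1+\frac{1}{p};2+\frac{1}{p};-x^p\right)}{\operatorname{arcsinh}_p(x)}, \qquad x\mapsto \frac{xF\left(2,\frac{1}{p};2+\frac{1}{p};-x^p\right)}{\arctan_p(x)}$$ are decreasing on $(0,1)$, and for every $p\in(0,1)$ the function $$x\mapsto\frac{\operatorname{arcsinh}_p(x)}{xF\left(-1+\frac{1}{p},\frac{1}{p};\frac{1}{p};-x^p\right)}$$ is also decreasing on $(0,1)$. Consequently, for all $p\in(0,1)$ and $x\in(0,1)$, $$xF\left(\frac{1}{p},1+\frac{1}{p};2+\frac{1}{p};-x^p\right)<\operatorname{arcsinh}_p(x)<xF\left(-1+\frac{1}{p},\frac{1}{p};\frac{1}{p};-x^p\right).$$ Moreover, the left-hand inequality here holds for all $x\in(0,1)$ and $p>0$, and so does the inequality $$xF\left(2,\frac{1}{p};2+\frac{1}{p};-x^p\right)<\arctan_p(x).$$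
   Context: For real $p>0$ and $x\in(0,1)$, define $$\arctan_p(x)=\int_0^x(1+t^p)^{-1}\,dt,\qquad \operatorname{arcsinh}_p(x)=\int_0^x(1+t^p)^{-1/p}\,dt.$$ $F(a,b;c;z)={}_2F_1(a,b;c;z)=\sum_{n\ge0}\frac{(a,n)(b,n)}{(c,n)}\frac{z^n}{n!}$ for $|z|<1$ is the Gaussian hypergeometric function, where $(a,n)=a(a+1)\cdots(a+n-1)$ (with $(a,0)=1$) is the rising factorial. *)

theory Defs
  imports "HOL-Analysis.Analysis"
begin

text \<open>
  Used only for \<open>\<bar>z\<bar> < 1\<close> and \<open>c\<close> not a non-positive integer, where the series converges and no
  denominator vanishes.
\<close>
definition hyp2F1 :: "real \<Rightarrow> real \<Rightarrow> real \<Rightarrow> real \<Rightarrow> real" where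
  "hyp2F1 a b c z =
     (\<Sum>n. pochhammer a n * pochhammer b n / pochhammer c n * (z ^ n / fact n))"

lemma hyp2F1_eq_eval_fps: "hyp2F1 a b c z = eval_fps (fps_hypergeo [a, b] [c] 1) z"
  by (simp add: hyp2F1_def eval_fps_def)

text \<open>
  The convention \<^term>\<open>0 powr p = (0::real)\<close> makes both integrands continuous at the left end point
  when \<open>p > 0\<close>.
\<close>
definition arctan_p :: "real \<Rightarrow> real \<Rightarrow> real" where
  "arctan_p p x = integral {0..x} (\<lambda>t. 1 / (1 + t powr p))"

definition arcsinh_p :: "real \<Rightarrow> real \<Rightarrow> real" where
  "arcsinh_p p x = integral {0..x} (\<lambda>t. (1 + t powr p) powr (- 1 / p))"

lemma integrable_arctan_p:
  assumes "p > 0"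
  shows "(\<lambda>t. 1 / (1 + t powr p)) integrable_on {0..x::real}"
proof (rule integrable_continuous_real)
  have "1 + t powr p \<noteq> 0" for t :: real
    using powr_ge_zero[of t p] by linarith
  thus "continuous_on {0..x} (\<lambda>t. 1 / (1 + t powr p))"
    using assms by (intro continuous_intros continuous_on_powr') auto
qed

lemma integrable_arcsinh_p:
  assumes "p > 0"
  shows "(\<lambda>t. (1 + t powr p) powr (- 1 / p)) integrable_on {0..x::real}"
proof (rule integrable_continuous_real)
  have "1 + t powr p > 0" for t :: real
    using powr_ge_zero[of t p] by linarith
  thus "continuous_on {0..x} (\<lambda>t. (1 + t powr p) powr (- 1 / p))"
    using assms by (intro continuous_on_powr' continuous_intros) (auto simp: less_imp_le less_imp_neq[symmetric])
qed

end

theory Submission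
  imports Defs
begin

text \<open>
  Put \<open>a = 1/p\<close> and \<open>f t = (1 + t\<^sup>p)\<^sup>-\<^sup>c\<close>, with \<open>c = a\<close> for \<open>arcsinh\<^sub>p\<close> and \<open>c = 1\<close> for
  \<open>arctan\<^sub>p\<close>. A hypergeometric series whose lower parameter exceeds one upper parameter by one is
  an incomplete moment of \<open>f\<close>:
  \<open>x F(c, a; 1 + a; -x\<^sup>p)\<close> is \<open>A(x) = \<integral>\<^sub>0\<^sup>x f\<close>, and \<open>x F(c, 1 + a; 2 + a; -x\<^sup>p)\<close> is \<open>M(x) / x\<^sup>p\<close> where
  \<open>M(x) = (p + 1) \<integral>\<^sub>0\<^sup>x t\<^sup>p f(t) dt\<close> (lemma \<open>hyp2F1_succ_primitive\<close>). Term by term,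
  \<open>F(2, a; 2 + a; z) = (1 - a\<^sup>2) F(1, a; 1 + a; z) + a\<^sup>2 F(1, 1 + a; 2 + a; z)\<close>, and by the binomial
  series \<open>F(a - 1, a; a; -z) = (1 + z)\<^sup>1\<^sup>-\<^sup>a\<close>. So everything reduces to two quotients:
  \<open>M / (x\<^sup>p A)\<close>, which gives both lower bounds, and \<open>A / B\<close> with \<open>B(x) = x (1 + x\<^sup>p)\<^sup>1\<^sup>-\<^sup>a\<close>.

  Numerator and denominator of each quotient vanish at \<open>0\<close>, so by the monotone form of
  l'Hopital's rule (lemma \<open>monotone_lhopital\<close>) the quotient decreases if the quotient of the
  derivatives does. For \<open>A / B\<close> that quotient is \<open>1 / (1 + p x\<^sup>p)\<close>. For \<open>M / (x\<^sup>p A)\<close> it is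
  \<open>(p + 1) q / (p + q)\<close> with \<open>q = x f / A\<close>, an increasing function of \<open>q\<close>; and \<open>q\<close> decreases by a
  second use of the same rule, since \<open>(x f)' / A' = 1 + x f' / f = 1 - c p + c p / (1 + x\<^sup>p)\<close>.
  The inequalities follow from comparing the same derivatives: \<open>A' < B'\<close>, and
  \<open>M' < (x\<^sup>p A)'\<close> because \<open>q < 1\<close>.
\<close>

section \<open>Monotone form of l'Hopital's rule\<close>

lemma less_of_deriv_less:
  fixes u v u' v' :: "real \<Rightarrow> real"
  assumes "a < b" "continuous_on {a..b} u" "continuous_on {a..b} v"
    and du: "\<And>t. a < t \<Longrightarrow> t < b \<Longrightarrow> (u has_real_derivative u' t) (at t)"
    and dv: "\<And>t. a < t \<Longrightarrow> t < b \<Longrightarrow> (v has_real_derivative v' t) (at t)"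
    and less: "\<And>t. a < t \<Longrightarrow> t < b \<Longrightarrow> u' t < v' t"
  shows "u b - u a < v b - v a"
proof -
  have "(\<lambda>t. v t - u t) a < (\<lambda>t. v t - u t) b"
  proof (rule DERIV_pos_imp_increasing_open[OF \<open>a < b\<close>])
    fix t assume t: "a < t" "t < b"
    show "\<exists>y. ((\<lambda>t. v t - u t) has_real_derivative y) (at t) \<and> 0 < y"
      using du[OF t] dv[OF t] less[OF t]
      by (intro exI[of _ "v' t - u' t"] conjI DERIV_diff) auto
  qed (intro continuous_intros assms)
  then show ?thesis by simp
qed

text \<open>
  If \<open>u'/v'\<close> decreases, then the mean slope of \<open>u\<close> against \<open>v\<close> over \<open>[x, y]\<close> is smaller than the
  mean slope \<open>u x / v x\<close> over \<open>[0, x]\<close>. Since \<open>u y / v y\<close> is a mediant of these two slopes, it is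
  smaller than \<open>u x / v x\<close>.
\<close>
lemma monotone_lhopital:
  fixes u v u' v' :: "real \<Rightarrow> real"
  assumes cu: "continuous_on {0..<b} u" and cv: "continuous_on {0..<b} v"
    and zero: "u 0 = 0" "v 0 = 0"
    and du: "\<And>t. 0 < t \<Longrightarrow> t < b \<Longrightarrow> (u has_real_derivative u' t) (at t)"
    and dv: "\<And>t. 0 < t \<Longrightarrow> t < b \<Longrightarrow> (v has_real_derivative v' t) (at t)"
    and pos: "\<And>t. 0 < t \<Longrightarrow> t < b \<Longrightarrow> v' t > 0"
    and anti: "strict_antimono_on {0<..<b} (\<lambda>t. u' t / v' t)"
  shows "strict_antimono_on {0<..<b} (\<lambda>t. u t / v t)"
proof (rule monotone_onI)
  fix x y assume x: "x \<in> {0<..<b}" and y: "y \<in> {0<..<b}" and "x < y"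
  define L where "L = u' x / v' x"
  have ratio: "u' t < u' s / v' s * v' t" if "0 < s" "s < t" "t < b" for s t
    using monotone_onD[OF anti, of s t] pos[of t] that by (simp add: divide_less_eq)
  have ratio': "u' t / v' t * v' s < u' s" if "0 < s" "s < t" "t < b" for s t
    using monotone_onD[OF anti, of s t] pos[of s] that by (simp add: less_divide_eq)
  have sub: "{0..x} \<subseteq> {0..<b}" "{x..y} \<subseteq> {0..<b}" "{0..y} \<subseteq> {0..<b}" using x y by auto
  have v: "0 < v x" "0 < v y"
    using less_of_deriv_less[of 0 x "\<lambda>_. 0" v "\<lambda>_. 0" v']
      less_of_deriv_less[of 0 y "\<lambda>_. 0" v "\<lambda>_. 0" v'] x y pos dv zero
      continuous_on_subset[OF cv sub(1)] continuous_on_subset[OF cv sub(3)]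
    by auto
  have dL: "((\<lambda>t. L * v t) has_real_derivative L * v' t) (at t)" if "0 < t" "t < b" for t
    by (intro DERIV_cmult dv that)
  note cont = continuous_on_subset[OF cu] continuous_on_subset[OF continuous_on_mult_left[OF cv]]
  \<comment> \<open>The slope \<open>L\<close> at \<open>x\<close> separates the two chords: it lies below the one over \<open>[0, x]\<close>
    and above the one over \<open>[x, y]\<close>.\<close>
  have "L * v x - L * v 0 < u x - u 0"
  proof (rule less_of_deriv_less[OF _ cont(2)[OF sub(1)] cont(1)[OF sub(1)] dL du])
    show "L * v' t < u' t" if "0 < t" "t < x" for t
      using ratio'[of t x] that x by (simp add: L_def)
  qed (use x in auto)
  then have L: "L < u x / v x" using v zero by (simp add: less_divide_eq)
  have "u y - u x < L * v y - L * v x"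
  proof (rule less_of_deriv_less[OF \<open>x < y\<close> cont(1)[OF sub(2)] cont(2)[OF sub(2)] du dL])
    show "u' t < L * v' t" if "x < t" "t < y" for t
      using ratio[of x t] that x y by (simp add: L_def)
  qed (use x y in auto)
  also have "\<dots> = L * (v y - v x)" by (simp add: algebra_simps)
  also have "\<dots> < u x / v x * (v y - v x)"
  proof (rule mult_strict_right_mono[OF L])
    show "0 < v y - v x"
      using less_of_deriv_less[of x y "\<lambda>_. 0" v "\<lambda>_. 0" v'] x y pos dv \<open>x < y\<close>
      by (auto intro: continuous_on_subset[OF cv sub(2)])
  qed
  finally have "u y < u x / v x * v y" using v by (simp add: right_diff_distrib)
  then show "u y / v y < u x / v x" using v by (simp add: divide_less_eq)
qed

section \<open>Hypergeometric series as primitives\<close>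

lemma hyp2F1_cancel:
  assumes "b > 0" "\<bar>z\<bar> < 1"
  shows "hyp2F1 c b b (- z) = (1 + z) powr (- c)"
proof -
  have nz: "pochhammer b n \<noteq> 0" for n
    using pochhammer_pos[OF assms(1), of n] by simp
  have "pochhammer c n * pochhammer b n / pochhammer b n * ((- z) ^ n / fact n)
      = ((- c) gchoose n) * z ^ n" for n
    using nz[of n] by (simp add: gbinomial_pochhammer power_minus[of z])
  then have "hyp2F1 c b b (- z) = (\<Sum>n. ((- c) gchoose n) * z ^ n)"
    by (simp add: hyp2F1_def)
  then show ?thesis using gen_binomial_real[OF assms(2), of "- c"] by (simp add: sums_iff)
qed

lemma pochhammer_quotient:
  assumes "(b::real) > 0"
  shows "pochhammer b n / pochhammer (1 + b) n = b / (b + real n)"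
proof -
  have "b * pochhammer (1 + b) n = pochhammer b n * (b + real n)"
    using pochhammer_rec[of b n] pochhammer_rec'[of b n] by (simp add: add.commute mult.commute)
  then show ?thesis
    using assms pochhammer_pos[of "1 + b" n] by (simp add: frac_eq_eq mult.commute)
qed

lemma hyp2F1_succ_coeff:
  fixes b c z :: real
  assumes "b > 0"
  shows "pochhammer c n * pochhammer b n / pochhammer (1 + b) n * ((- z) ^ n / fact n)
       = ((- c) gchoose n) * (b / (b + real n)) * z ^ n"
proof -
  have "pochhammer c n * pochhammer b n / pochhammer (1 + b) n * ((- z) ^ n / fact n)
      = pochhammer c n * (pochhammer b n / pochhammer (1 + b) n) * ((- z) ^ n / fact n)"
    by simp
  also have "\<dots> = pochhammer c n * (b / (b + real n)) * ((- z) ^ n / fact n)"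
    by (simp only: pochhammer_quotient[OF assms])
  also have "\<dots> = ((- c) gchoose n) * (b / (b + real n)) * z ^ n"
    by (simp add: gbinomial_pochhammer power_minus[of z] mult_ac)
  finally show ?thesis .
qed

text \<open>
  The factors \<open>b / (b + n)\<close> lie between \<open>0\<close> and \<open>1\<close>, so the binomial series dominates.
\<close>
lemma summable_succ_coeff:
  fixes b c z :: real
  assumes "b > 0" "\<bar>z\<bar> < 1"
  shows "summable (\<lambda>n. ((- c) gchoose n) * (b / (b + real n)) * z ^ n)"
proof -
  obtain r where r: "\<bar>z\<bar> < r" "r < 1" using assms(2) dense by blast
  have "summable (\<lambda>n. ((- c) gchoose n) * r ^ n)"
    using gen_binomial_real[of r "- c"] r by (auto simp: sums_iff)
  then have "summable (\<lambda>n. norm (((- c) gchoose n) * z ^ n))"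
    using r by (intro powser_insidea[where x = r]) auto
  then show ?thesis
  proof (rule summable_comparison_test'[where N = 0])
    fix n :: nat
    have "b / (b + real n) \<le> 1" "0 \<le> b / (b + real n)" using assms(1) by (simp_all add: divide_simps)
    then have "(\<bar>(- c) gchoose n\<bar> * \<bar>z ^ n\<bar>) * (b / (b + real n)) \<le> (\<bar>(- c) gchoose n\<bar> * \<bar>z ^ n\<bar>) * 1"
      by (intro mult_left_mono) auto
    then show "norm (((- c) gchoose n) * (b / (b + real n)) * z ^ n) \<le> norm (((- c) gchoose n) * z ^ n)"
      using assms(1) by (simp add: abs_mult mult_ac)
  qed
qed

text \<open>
  The operator \<open>b + z d/dz\<close> multiplies the coefficient of \<open>z\<^sup>n\<close> by \<open>b + n\<close>. This cancels the
  denominators of the series and leaves the binomial series.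
\<close>
lemma hyp2F1_succ_euler_equation:
  assumes b: "b > 0" and z: "\<bar>z\<bar> < 1"
  obtains D where "((\<lambda>z. hyp2F1 c b (1 + b) (- z)) has_real_derivative D) (at z)"
    and "b * hyp2F1 c b (1 + b) (- z) + z * D = b * (1 + z) powr (- c)"
proof -
  define s where "s n = ((- c) gchoose n) * (b / (b + real n))" for n :: nat
  have F: "hyp2F1 c b (1 + b) (- w) = (\<Sum>n. s n * w ^ n)" for w
    unfolding hyp2F1_def hyp2F1_succ_coeff[OF b] s_def ..
  have summ: "summable (\<lambda>n. s n * w ^ n)" if "\<bar>w\<bar> < 1" for w
    using summable_succ_coeff[OF b that] by (simp add: s_def)
  define D where "D = (\<Sum>n. diffs s n * z ^ n)"
  have der: "((\<lambda>z. hyp2F1 c b (1 + b) (- z)) has_real_derivative D) (at z)"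
    unfolding F D_def by (rule termdiffs_strong'[of 1]) (use summ z in auto)
  have "summable (\<lambda>n. diffs s n * z ^ n)"
    by (rule termdiff_converges[of z 1]) (use summ z in auto)
  then have "(\<lambda>n. of_nat n * s n * z ^ (n - Suc 0)) sums D"
    using diffs_equiv by (simp add: D_def)
  then have "(\<lambda>n. z * (of_nat n * s n * z ^ (n - Suc 0))) sums (z * D)"
    by (rule sums_mult)
  then have zD: "(\<lambda>n. of_nat n * s n * z ^ n) sums (z * D)"
    by (rule sums_cong[THEN iffD1, rotated]) (auto simp: gr0_conv_Suc split: nat_diff_split intro: nat.exhaust)
  have "(\<lambda>n. b * (s n * z ^ n) + of_nat n * s n * z ^ n) sums (b * hyp2F1 c b (1 + b) (- z) + z * D)"
    unfolding F by (intro sums_add sums_mult zD summable_sums summ z)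
  moreover have "b * (s n * z ^ n) + of_nat n * s n * z ^ n = b * (((- c) gchoose n) * z ^ n)" for n
  proof -
    have "s n * (b + real n) = b * ((- c) gchoose n)"
      using b by (simp add: s_def)
    then show ?thesis by (metis (no_types) distrib_right mult.assoc mult.commute)
  qed
  ultimately have "(\<lambda>n. b * (((- c) gchoose n) * z ^ n)) sums (b * hyp2F1 c b (1 + b) (- z) + z * D)"
    by simp
  moreover have "(\<lambda>n. b * (((- c) gchoose n) * z ^ n)) sums (b * (1 + z) powr (- c))"
    by (intro sums_mult gen_binomial_real z)
  ultimately show ?thesis using that[OF der] sums_unique2 by blast
qed

lemma powr_less_one:
  fixes x p :: real assumes "0 \<le> x" "x < 1" "p > 0" shows "x powr p < 1"
  using powr_less_mono2[of p x 1] assms by simp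

text \<open>
  The substitution \<open>z = x\<^sup>p\<close> turns the Euler operator of the preceding lemma into an ordinary
  derivative, with \<open>x\<close> to the power \<open>p * b\<close> as integrating factor. The case \<open>b = 1/p\<close> gives a primitive
  of \<open>(1 + t\<^sup>p)\<^sup>-\<^sup>c\<close>, and \<open>b = 1 + 1/p\<close> gives one of \<open>(p + 1) t\<^sup>p (1 + t\<^sup>p)\<^sup>-\<^sup>c\<close>.
\<close>
lemma hyp2F1_succ_primitive:
  assumes p: "p > 0" and b: "b > 0" and x: "0 < x" "x < 1"
  shows "((\<lambda>x. x powr (p * b) * hyp2F1 c b (1 + b) (- (x powr p))) has_real_derivative
           p * b * x powr (p * b - 1) * (1 + x powr p) powr (- c)) (at x)"
proof -
  have "\<bar>x powr p\<bar> < 1" using powr_less_one[of x p] x p by simp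
  then obtain D where D: "((\<lambda>z. hyp2F1 c b (1 + b) (- z)) has_real_derivative D) (at (x powr p))"
    and eq: "b * hyp2F1 c b (1 + b) (- (x powr p)) + x powr p * D = b * (1 + x powr p) powr (- c)"
    using hyp2F1_succ_euler_equation[OF b] by metis
  have "((\<lambda>x. hyp2F1 c b (1 + b) (- (x powr p))) has_real_derivative D * (p * x powr (p - 1))) (at x)"
    using DERIV_chain2[OF D has_real_derivative_powr[OF x(1), of p]] by simp
  from DERIV_mult[OF has_real_derivative_powr[OF x(1), of "p * b"] this]
  have "((\<lambda>x. x powr (p * b) * hyp2F1 c b (1 + b) (- (x powr p))) has_real_derivative
      p * b * x powr (p * b - 1) * hyp2F1 c b (1 + b) (- (x powr p))
      + D * (p * x powr (p - 1)) * x powr (p * b)) (at x)" .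
  moreover have "x powr (p - 1) * x powr (p * b) = x powr (p * b - 1) * x powr p"
    by (simp add: powr_add[symmetric] algebra_simps)
  then have "p * b * x powr (p * b - 1) * hyp2F1 c b (1 + b) (- (x powr p))
      + D * (p * x powr (p - 1)) * x powr (p * b)
      = p * x powr (p * b - 1) * (b * hyp2F1 c b (1 + b) (- (x powr p)) + x powr p * D)"
    by (simp add: algebra_simps)
  ultimately show ?thesis unfolding eq by (simp only: mult.assoc mult.commute mult.left_commute)
qed

lemma continuous_on_hyp2F1_succ:
  assumes p: "p > 0" and b: "b > 0"
  shows "continuous_on {0..<1} (\<lambda>x. hyp2F1 c b (1 + b) (- (x powr p)))"
proof -
  have "continuous_on {-1<..<1} (\<lambda>z. hyp2F1 c b (1 + b) (- z))"
  proof (rule continuous_at_imp_continuous_on, rule ballI)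
    fix z :: real assume "z \<in> {-1<..<1}"
    then have "\<bar>z\<bar> < 1" by auto
    then show "isCont (\<lambda>z. hyp2F1 c b (1 + b) (- z)) z"
      using hyp2F1_succ_euler_equation[OF b] DERIV_isCont by metis
  qed
  moreover have "continuous_on {0..<1::real} (\<lambda>x. x powr p)"
    using p by (intro continuous_on_powr' continuous_intros) auto
  moreover have "(\<lambda>x. x powr p) ` {0..<1} \<subseteq> {-1<..<1}"
  proof
    fix y assume "y \<in> (\<lambda>x. x powr p) ` {0..<1}"
    then show "y \<in> {-1<..<1}"
      using powr_less_one[OF _ _ p] by (auto intro: less_le_trans[of _ 0])
  qed
  ultimately show ?thesis by (rule continuous_on_compose2)
qed

lemma has_derivative_times_hyp2F1:
  assumes p: "p > 0" and x: "0 < x" "x < 1"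
  shows "((\<lambda>x. x * hyp2F1 c (1/p) (1 + 1/p) (- (x powr p))) has_real_derivative
           (1 + x powr p) powr (- c)) (at x)"
proof (rule has_field_derivative_transform_within_open[of _ _ _ "{0<..}"])
  show "((\<lambda>x. x powr (p * (1/p)) * hyp2F1 c (1/p) (1 + 1/p) (- (x powr p))) has_real_derivative
           (1 + x powr p) powr (- c)) (at x)"
    using hyp2F1_succ_primitive[OF p _ x, of "1/p" c] p x by simp
qed (use p x in auto)

lemma continuous_on_times_hyp2F1:
  assumes "p > 0"
  shows "continuous_on {0..<1} (\<lambda>x. x * hyp2F1 c (1/p) (1 + 1/p) (- (x powr p)))"
  using assms by (intro continuous_intros continuous_on_hyp2F1_succ) auto

lemma integral_hyp2F1:
  assumes p: "p > 0" and x: "0 < x" "x < 1"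
  shows "integral {0..x} (\<lambda>t. (1 + t powr p) powr (- c)) =
           x * hyp2F1 c (1/p) (1 + 1/p) (- (x powr p))"
proof -
  let ?A = "\<lambda>x. x * hyp2F1 c (1/p) (1 + 1/p) (- (x powr p))"
  have "((\<lambda>t. (1 + t powr p) powr (- c)) has_integral ?A x - ?A 0) {0..x}"
  proof (rule fundamental_theorem_of_calculus_interior)
    show "continuous_on {0..x} ?A"
      using x by (intro continuous_on_subset[OF continuous_on_times_hyp2F1[OF p]]) auto
    show "(?A has_vector_derivative (1 + t powr p) powr (- c)) (at t)" if "t \<in> {0<..<x}" for t
      using has_derivative_times_hyp2F1[OF p, of t c] that x
      by (simp add: has_real_derivative_iff_has_vector_derivative)
  qed (use x in auto)
  then show ?thesis by (simp add: integral_unique)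
qed

lemma arcsinh_p_eq_hyp2F1:
  assumes "p > 0" "0 < x" "x < 1"
  shows "arcsinh_p p x = x * hyp2F1 (1/p) (1/p) (1 + 1/p) (- (x powr p))"
  using integral_hyp2F1[OF assms, of "1/p"] by (simp add: arcsinh_p_def)

lemma arctan_p_eq_hyp2F1:
  assumes "p > 0" "0 < x" "x < 1"
  shows "arctan_p p x = x * hyp2F1 1 (1/p) (1 + 1/p) (- (x powr p))"
proof -
  have "1 / (1 + t powr p) = (1 + t powr p) powr (- 1)" for t
    using powr_ge_zero[of t p] by (subst powr_minus) (auto simp: divide_inverse)
  then show ?thesis
    using integral_hyp2F1[OF assms, of 1] by (simp add: arctan_p_def)
qed

text \<open>
  The denominators \<open>a + n\<close> and \<open>1 + a + n\<close> on the left are separated by partial fractions: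
  \<open>(1 + n) a (1 + a) / ((a + n) (1 + a + n)) = (1 - a\<^sup>2) a / (a + n) + a\<^sup>2 (1 + a) / (1 + a + n)\<close>.
\<close>
lemma hyp2F1_two_contiguous:
  assumes a: "a > 0" and z: "\<bar>z\<bar> < 1"
  shows "hyp2F1 2 a (2 + a) (- z) =
    (1 - a\<^sup>2) * hyp2F1 1 a (1 + a) (- z) + a\<^sup>2 * hyp2F1 1 (1 + a) (2 + a) (- z)"
proof -
  define g where "g n = ((- 1) gchoose n) * z ^ n" for n :: nat
  have F: "hyp2F1 1 b (1 + b) (- z) = (\<Sum>n. g n * (b / (b + real n)))"
    and S: "summable (\<lambda>n. g n * (b / (b + real n)))" if "b > 0" for b
    using summable_succ_coeff[OF that z, of 1]
    unfolding hyp2F1_def hyp2F1_succ_coeff[OF that] g_def by (simp_all add: mult_ac)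
  have coeff: "pochhammer 2 n * pochhammer a n / pochhammer (2 + a) n * ((- z) ^ n / fact n)
      = (1 - a\<^sup>2) * (g n * (a / (a + real n)))
        + a\<^sup>2 * (g n * ((1 + a) / ((1 + a) + real n)))" for n
  proof -
    have "pochhammer a n / pochhammer (2 + a) n
        = (pochhammer a n / pochhammer (1 + a) n)
          * (pochhammer (1 + a) n / pochhammer (1 + (1 + a)) n)"
      using pochhammer_pos[of "1 + a" n] a by (simp add: add.assoc[symmetric])
    also have "\<dots> = (a / (a + real n)) * ((1 + a) / ((1 + a) + real n))"
      using a by (simp only: pochhammer_quotient)
    finally have q: "pochhammer a n / pochhammer (2 + a) n
        = (a / (a + real n)) * ((1 + a) / ((1 + a) + real n))" .
    have two: "pochhammer 2 n = (fact n * (1 + real n) :: real)"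
      using pochhammer_rec[of "1 :: real" n]
      by (simp add: pochhammer_fact[symmetric] algebra_simps)
    have "pochhammer 2 n * pochhammer a n / pochhammer (2 + a) n * ((- z) ^ n / fact n)
        = (pochhammer 2 n / fact n) * (pochhammer a n / pochhammer (2 + a) n) * (- z) ^ n"
      by simp
    also have "\<dots> = (1 + real n) * ((a / (a + real n)) * ((1 + a) / ((1 + a) + real n))) * g n"
      by (simp add: q two g_def power_minus[of z] gbinomial_pochhammer pochhammer_fact[symmetric])
    also have "(1 + real n) * ((a / (a + real n)) * ((1 + a) / ((1 + a) + real n)))
        = (1 - a\<^sup>2) * (a / (a + real n)) + a\<^sup>2 * ((1 + a) / ((1 + a) + real n))"
    proof -
      have "a + real n \<noteq> 0" "(1 + a) + real n \<noteq> 0" using a by linarith+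
      then show ?thesis by (simp add: divide_simps) (simp add: algebra_simps power2_eq_square)
    qed
    finally show ?thesis
      by (simp only: distrib_left distrib_right mult.assoc mult.commute mult.left_commute)
  qed
  have "hyp2F1 2 a (2 + a) (- z) = (1 - a\<^sup>2) * (\<Sum>n. g n * (a / (a + real n)))
      + a\<^sup>2 * (\<Sum>n. g n * ((1 + a) / ((1 + a) + real n)))"
    unfolding hyp2F1_def coeff using a
    by (intro sums_unique[symmetric] sums_add sums_mult summable_sums S) auto
  also have "\<dots> = (1 - a\<^sup>2) * hyp2F1 1 a (1 + a) (- z) + a\<^sup>2 * hyp2F1 1 (1 + a) (2 + a) (- z)"
    using F[of a] F[of "1 + a"] a by (simp add: add.assoc[symmetric])
  finally show ?thesis .
qed

section \<open>Monotone quotients\<close>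

lemma DERIV_one_plus_powr_powr:
  fixes x p r :: real
  assumes "0 < x"
  shows "((\<lambda>x. (1 + x powr p) powr r) has_real_derivative
           r * p * (x powr p / x) * (1 + x powr p) powr (r - 1)) (at x)"
proof -
  have "1 + x powr p > 0" using powr_ge_zero[of x p] by linarith
  then have "((\<lambda>x. (1 + x powr p) powr r) has_real_derivative
      (r * (1 + x powr p) powr (r - 1)) * (p * x powr (p - 1))) (at x)"
    using assms by (intro DERIV_chain2[OF has_real_derivative_powr[of _ r]] derivative_eq_intros) auto
  then show ?thesis using assms by (simp add: powr_diff mult_ac)
qed

lemma DERIV_times_one_plus_powr_powr:
  fixes x p r :: real
  assumes "0 < x"
  shows "((\<lambda>x. x * (1 + x powr p) powr r) has_real_derivative
           (1 + (1 + r * p) * x powr p) * (1 + x powr p) powr (r - 1)) (at x)"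
proof -
  have pos: "1 + x powr p > 0" using powr_ge_zero[of x p] by linarith
  have "((\<lambda>x. x * (1 + x powr p) powr r) has_real_derivative
      1 * (1 + x powr p) powr r + r * p * (x powr p / x) * (1 + x powr p) powr (r - 1) * x) (at x)"
    by (intro DERIV_mult DERIV_ident DERIV_one_plus_powr_powr assms)
  moreover have "(1 + x powr p) powr r = (1 + x powr p) * (1 + x powr p) powr (r - 1)"
    using pos by (simp add: powr_diff)
  then have "1 * (1 + x powr p) powr r + r * p * (x powr p / x) * (1 + x powr p) powr (r - 1) * x
      = (1 + (1 + r * p) * x powr p) * (1 + x powr p) powr (r - 1)"
    using assms by (simp add: algebra_simps)
  ultimately show ?thesis by simp
qed

lemma continuous_on_times_one_plus_powr_powr:
  fixes p r :: real
  assumes "p > 0"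
  shows "continuous_on {0..<1} (\<lambda>x. x * (1 + x powr p) powr r)"
proof -
  have "1 + x powr p \<noteq> 0" for x :: real using powr_ge_zero[of x p] by linarith
  then show ?thesis
    using assms by (intro continuous_intros continuous_on_powr') auto
qed

text \<open>
  The right-hand side is the integral of \<open>(1 + t\<^sup>p)\<^sup>-\<^sup>c\<close> over \<open>[0, x]\<close>; the left-hand side is the
  length of that interval times the smallest value of the integrand.
\<close>
lemma integrand_less_mean:
  assumes p: "p > 0" and c: "c > 0" and x: "0 < x" "x < 1"
  shows "x * (1 + x powr p) powr (- c) < x * hyp2F1 c (1/p) (1 + 1/p) (- (x powr p))"
proof -
  let ?A = "\<lambda>x. x * hyp2F1 c (1/p) (1 + 1/p) (- (x powr p))"
  let ?U = "\<lambda>x. x * (1 + x powr p) powr (- c)"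
  have "?U x - ?U 0 < ?A x - ?A 0"
  proof (rule less_of_deriv_less[OF x(1)])
    show "continuous_on {0..x} ?A" "continuous_on {0..x} ?U"
      using x by (auto intro!: continuous_on_subset[OF continuous_on_times_hyp2F1[OF p]]
          continuous_on_subset[OF continuous_on_times_one_plus_powr_powr[OF p]])
    fix t assume t: "0 < t" "t < x"
    show "(?U has_real_derivative
        (1 + (1 + - c * p) * t powr p) * (1 + t powr p) powr (- c - 1)) (at t)"
      by (rule DERIV_times_one_plus_powr_powr[OF t(1)])
    show "(?A has_real_derivative (1 + t powr p) powr (- c)) (at t)"
      using has_derivative_times_hyp2F1[OF p t(1)] t x by simp
    have "1 + t powr p > 0" using powr_ge_zero[of t p] by linarith
    then have "(1 + t powr p) powr (- c) = (1 + t powr p) * (1 + t powr p) powr (- c - 1)"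
      by (simp add: powr_diff)
    moreover have "(1 + (1 + - c * p) * t powr p) * (1 + t powr p) powr (- c - 1)
        < (1 + t powr p) * (1 + t powr p) powr (- c - 1)"
      using t p c \<open>1 + t powr p > 0\<close> by (intro mult_strict_right_mono) (auto simp: algebra_simps)
    ultimately show "(1 + (1 + - c * p) * t powr p) * (1 + t powr p) powr (- c - 1)
        < (1 + t powr p) powr (- c)" by simp
  qed
  then show ?thesis by simp
qed

text \<open>
  This is the inner use of l'Hopital's rule: the quotient of derivatives is the logarithmic
  derivative \<open>1 + x f' / f\<close> of \<open>x f\<close> with respect to \<open>log x\<close>, where \<open>f = (1 + x\<^sup>p)\<^sup>-\<^sup>c\<close>.
\<close>
lemma integrand_div_mean_antimono:
  assumes p: "p > 0" and c: "c > 0"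
  shows "strict_antimono_on {0<..<1} (\<lambda>x. x * (1 + x powr p) powr (- c) /
           (x * hyp2F1 c (1/p) (1 + 1/p) (- (x powr p))))"
proof (rule monotone_lhopital)
  fix t :: real assume t: "0 < t" "t < 1"
  show "((\<lambda>x. x * (1 + x powr p) powr (- c)) has_real_derivative
      (1 + (1 + - c * p) * t powr p) * (1 + t powr p) powr (- c - 1)) (at t)"
    by (rule DERIV_times_one_plus_powr_powr[OF t(1)])
  show "((\<lambda>x. x * hyp2F1 c (1/p) (1 + 1/p) (- (x powr p))) has_real_derivative
      (1 + t powr p) powr (- c)) (at t)"
    using has_derivative_times_hyp2F1[OF p t(1)] t by simp
  show "0 < (1 + t powr p) powr (- c)"
    using powr_ge_zero[of t p] by (simp add: add_nonneg_eq_0_iff)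
next
  have eq: "(1 + (1 + - c * p) * x powr p) * (1 + x powr p) powr (- c - 1) / (1 + x powr p) powr (- c)
      = (1 - c * p) + c * p / (1 + x powr p)" for x :: real
  proof -
    have "1 + x powr p > 0" using powr_ge_zero[of x p] by linarith
    then have "(1 + x powr p) powr (- c - 1) / (1 + x powr p) powr (- c) = 1 / (1 + x powr p)"
      by (simp add: powr_diff)
    then have "(1 + (1 + - c * p) * x powr p) * (1 + x powr p) powr (- c - 1) / (1 + x powr p) powr (- c)
       = (1 + (1 + - c * p) * x powr p) * (1 / (1 + x powr p))" by (metis times_divide_eq_right)
    then show ?thesis using \<open>1 + x powr p > 0\<close> by (simp add: field_simps)
  qed
  show "strict_antimono_on {0<..<1} (\<lambda>x. (1 + (1 + - c * p) * x powr p)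
      * (1 + x powr p) powr (- c - 1) / (1 + x powr p) powr (- c))"
    unfolding eq using p c
    by (auto intro!: monotone_onI divide_strict_left_mono powr_less_mono2 mult_pos_pos add_pos_nonneg)
qed (use continuous_on_times_hyp2F1[OF p] continuous_on_times_one_plus_powr_powr[OF p] in auto)

text \<open>
  The quotient below is, up to the factor \<open>p + 1\<close>, the average of \<open>(t/x)\<^sup>p\<close> over \<open>[0, x]\<close> with
  weight \<open>f t = (1 + t\<^sup>p)\<^sup>-\<^sup>c\<close>. As \<open>x\<close> grows, the weight decays more between \<open>0\<close> and \<open>x\<close>, which moves
  the average towards smaller values of \<open>t/x\<close>. As \<open>x\<close> tends to \<open>0\<close>, the weight becomes
  constant and the quotient tends to \<open>1\<close>.
\<close>
lemma
  assumes p: "p > 0" and c: "c > 0"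
  shows hyp2F1_shift_quotient_antimono:
      "strict_antimono_on {0<..<1} (\<lambda>x. hyp2F1 c (1 + 1/p) (2 + 1/p) (- (x powr p)) /
           hyp2F1 c (1/p) (1 + 1/p) (- (x powr p)))"
    and hyp2F1_shift_less: "\<And>x. 0 < x \<Longrightarrow> x < 1 \<Longrightarrow>
      hyp2F1 c (1 + 1/p) (2 + 1/p) (- (x powr p)) < hyp2F1 c (1/p) (1 + 1/p) (- (x powr p))"
proof -
  define A where "A x = x * hyp2F1 c (1/p) (1 + 1/p) (- (x powr p))" for x
  define U where "U x = x * (1 + x powr p) powr (- c)" for x
  define M where "M x = x powr (p + 1) * hyp2F1 c (1 + 1/p) (2 + 1/p) (- (x powr p))" for x
  define V where "V x = x powr p * A x" for x
  define M' where "M' x = (p + 1) * (x powr p / x) * U x" for x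
  define V' where "V' x = (x powr p / x) * (p * A x + U x)" for x
  have U_pos: "U x > 0" if "0 < x" for x
    using that powr_ge_zero[of x p] by (simp add: U_def add_nonneg_eq_0_iff)
  have U_less: "U x < A x" if "0 < x" "x < 1" for x
    using integrand_less_mean[OF p c that] by (simp add: U_def A_def)
  have A_pos: "A x > 0" if "0 < x" "x < 1" for x
    using U_pos[of x] U_less[of x] that by simp
  have p1: "p * (1 + 1/p) = p + 1" using p by (simp add: field_simps)
  have dM: "(M has_real_derivative M' x) (at x)" if "0 < x" "x < 1" for x
    using hyp2F1_succ_primitive[OF p _ that, of "1 + 1/p" c] p that
    by (simp add: add_pos_pos mult.assoc M_def[abs_def] M'_def U_def p1 add.assoc[symmetric])
  have dV: "(V has_real_derivative V' x) (at x)" if "0 < x" "x < 1" for x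
    unfolding V_def[abs_def]
  proof (rule DERIV_cong)
    show "((\<lambda>x. x powr p * A x) has_real_derivative
        p * x powr (p - 1) * A x + (1 + x powr p) powr (- c) * x powr p) (at x)"
      unfolding A_def
      by (intro DERIV_mult has_real_derivative_powr has_derivative_times_hyp2F1 that p)
    show "p * x powr (p - 1) * A x + (1 + x powr p) powr (- c) * x powr p = V' x"
      using that by (simp add: V'_def U_def powr_diff field_simps)
  qed
  have cM: "continuous_on {0..<1} M"
    using continuous_on_hyp2F1_succ[OF p, of "1 + 1/p" c] p unfolding M_def[abs_def]
    by (intro continuous_on_mult continuous_on_powr' continuous_intros)
      (auto simp: add.assoc[symmetric] add_pos_pos)
  have cV: "continuous_on {0..<1} V"
    using p unfolding V_def[abs_def] A_def
    by (intro continuous_on_mult continuous_on_powr' continuous_on_times_hyp2F1 continuous_intros) auto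
  have zero: "M 0 = 0" "V 0 = 0" by (simp_all add: M_def V_def)
  have V'_pos: "V' x > 0" if "0 < x" "x < 1" for x
    using that p A_pos[of x] U_pos[of x] by (simp add: V'_def add_pos_pos)
  have V_pos: "V x > 0" if "0 < x" "x < 1" for x
    using that A_pos[of x] by (simp add: V_def)
  have quot: "M x / V x = hyp2F1 c (1 + 1/p) (2 + 1/p) (- (x powr p)) /
      hyp2F1 c (1/p) (1 + 1/p) (- (x powr p))" if "0 < x" for x
    using that by (simp add: M_def V_def A_def powr_add)
  have "strict_antimono_on {0<..<1} (\<lambda>x. M x / V x)"
  proof (rule monotone_lhopital[OF cM cV zero dM dV V'_pos])
    show "strict_antimono_on {0<..<1} (\<lambda>x. M' x / V' x)"
    proof (rule monotone_onI)
      fix x y :: real assume x: "x \<in> {0<..<1}" and y: "y \<in> {0<..<1}" and "x < y"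
      \<comment> \<open>The map from \<open>q = U/A\<close> to \<open>U / (p A + U) = q / (p + q)\<close> is increasing; the following
        steps verify this after clearing denominators.\<close>
      have "U y / A y < U x / A x"
        using monotone_onD[OF integrand_div_mean_antimono[OF p c] x y \<open>x < y\<close>]
        by (simp add: U_def A_def)
      then have "U y * A x < U x * A y"
        using A_pos[of x] A_pos[of y] x y by (simp add: field_simps)
      then have "p * (U y * A x) < p * (U x * A y)"
        using p by simp
      then have "U y * (p * A x + U x) < U x * (p * A y + U y)"
        by (simp add: algebra_simps)
      then have "U y / (p * A y + U y) < U x / (p * A x + U x)"
        using p A_pos[of x] A_pos[of y] U_pos[of x] U_pos[of y] x y
        by (simp add: divide_less_eq less_divide_eq add_pos_pos mult.commute)
      then have "(p + 1) * (U y / (p * A y + U y)) < (p + 1) * (U x / (p * A x + U x))"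
        using p by (intro mult_strict_left_mono) auto
      moreover have "M' t / V' t = (p + 1) * (U t / (p * A t + U t))" if "0 < t" for t
        using that by (simp add: M'_def V'_def)
      ultimately show "M' y / V' y < M' x / V' x" using x y by simp
    qed
  qed auto
  then show "strict_antimono_on {0<..<1} (\<lambda>x. hyp2F1 c (1 + 1/p) (2 + 1/p) (- (x powr p)) /
           hyp2F1 c (1/p) (1 + 1/p) (- (x powr p)))"
    by (auto simp: monotone_on_def quot)
  fix x :: real assume x: "0 < x" "x < 1"
  have sub: "{0..x} \<subseteq> {0..<1}" using x by auto
  have "M x - M 0 < V x - V 0"
  proof (rule less_of_deriv_less[OF x(1) continuous_on_subset[OF cM sub]
        continuous_on_subset[OF cV sub] dM dV])
    fix t assume t: "0 < t" "t < x"
    have "p * U t < p * A t" using U_less[of t] t x p by simp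
    then have "(p + 1) * U t < p * A t + U t" by (simp add: algebra_simps)
    then have "(t powr p / t) * ((p + 1) * U t) < (t powr p / t) * (p * A t + U t)"
      using t by (intro mult_strict_left_mono) auto
    then show "M' t < V' t" by (simp add: M'_def V'_def mult_ac)
  qed (use x in auto)
  then have "x powr (p + 1) * hyp2F1 c (1 + 1/p) (2 + 1/p) (- (x powr p))
      < x powr (p + 1) * hyp2F1 c (1/p) (1 + 1/p) (- (x powr p))"
    using x by (simp add: zero M_def V_def A_def powr_add mult_ac)
  then show "hyp2F1 c (1 + 1/p) (2 + 1/p) (- (x powr p)) < hyp2F1 c (1/p) (1 + 1/p) (- (x powr p))"
    using x by simp
qed

lemma hyp2F1_pos:
  assumes "p > 0" "c > 0" "0 < x" "x < 1"
  shows "hyp2F1 c (1/p) (1 + 1/p) (- (x powr p)) > 0"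
proof -
  have "0 \<le> x * (1 + x powr p) powr (- c)" using assms by simp
  then have "0 < x * hyp2F1 c (1/p) (1 + 1/p) (- (x powr p))"
    using integrand_less_mean[OF assms] by linarith
  then show ?thesis using assms by (simp add: zero_less_mult_iff)
qed

lemma arcsinh_p_lower:
  assumes p: "p > 0"
  shows "strict_antimono_on {0<..<1}
        (\<lambda>x. x * hyp2F1 (1/p) (1 + 1/p) (2 + 1/p) (- (x powr p)) / arcsinh_p p x)"
    and "\<And>x. 0 < x \<Longrightarrow> x < 1 \<Longrightarrow>
        x * hyp2F1 (1/p) (1 + 1/p) (2 + 1/p) (- (x powr p)) < arcsinh_p p x"
  using hyp2F1_shift_quotient_antimono[OF p, of "1/p"] hyp2F1_shift_less[OF p, of "1/p"] p
  by (auto simp: monotone_on_def arcsinh_p_eq_hyp2F1)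

text \<open>
  By the contiguous relation the quotient is the affine image \<open>1 - a\<^sup>2 + a\<^sup>2 q\<close> of the shifted
  quotient \<open>q\<close>, where \<open>a = 1/p\<close>. The map is increasing and fixes \<open>1\<close>, so it carries over both the
  monotonicity and the bound \<open>q < 1\<close>.
\<close>
lemma arctan_p_lower:
  assumes p: "p > 0"
  shows "strict_antimono_on {0<..<1}
        (\<lambda>x. x * hyp2F1 2 (1/p) (2 + 1/p) (- (x powr p)) / arctan_p p x)"
    and "\<And>x. 0 < x \<Longrightarrow> x < 1 \<Longrightarrow>
        x * hyp2F1 2 (1/p) (2 + 1/p) (- (x powr p)) < arctan_p p x"
proof -
  define q where "q x = hyp2F1 1 (1 + 1/p) (2 + 1/p) (- (x powr p)) /
      hyp2F1 1 (1/p) (1 + 1/p) (- (x powr p))" for x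
  have quot: "x * hyp2F1 2 (1/p) (2 + 1/p) (- (x powr p)) / arctan_p p x
      = (1 - (1/p)\<^sup>2) + (1/p)\<^sup>2 * q x" if "0 < x" "x < 1" for x
  proof -
    have "\<bar>x powr p\<bar> < 1" using powr_less_one[of x p] that p by simp
    then show ?thesis
      using hyp2F1_two_contiguous[of "1/p" "x powr p"] hyp2F1_pos[OF p, of 1 x] that p
      by (simp add: arctan_p_eq_hyp2F1 q_def add_divide_distrib)
  qed
  have anti: "strict_antimono_on {0<..<1} q"
    using hyp2F1_shift_quotient_antimono[OF p, of 1] by (simp add: q_def[abs_def])
  have less: "(1/p)\<^sup>2 * a < (1/p)\<^sup>2 * b" if "a < b" for a b
    using that p by (intro mult_strict_left_mono) auto
  show "strict_antimono_on {0<..<1}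
        (\<lambda>x. x * hyp2F1 2 (1/p) (2 + 1/p) (- (x powr p)) / arctan_p p x)"
  proof (rule monotone_onI)
    fix x y :: real assume xy: "x \<in> {0<..<1}" "y \<in> {0<..<1}" "x < y"
    show "y * hyp2F1 2 (1/p) (2 + 1/p) (- (y powr p)) / arctan_p p y
        < x * hyp2F1 2 (1/p) (2 + 1/p) (- (x powr p)) / arctan_p p x"
      using less[OF monotone_onD[OF anti xy]] xy quot[of x] quot[of y] by simp
  qed
  fix x :: real assume x: "0 < x" "x < 1"
  have pos: "arctan_p p x > 0"
    using hyp2F1_pos[OF p, of 1 x] x p by (simp add: arctan_p_eq_hyp2F1)
  have "q x < 1"
    using hyp2F1_shift_less[OF p, of 1 x] hyp2F1_pos[OF p, of 1 x] x by (simp add: q_def)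
  then have "x * hyp2F1 2 (1/p) (2 + 1/p) (- (x powr p)) / arctan_p p x < 1"
    using quot[OF x] less[of "q x" 1] by simp
  then show "x * hyp2F1 2 (1/p) (2 + 1/p) (- (x powr p)) < arctan_p p x"
    using pos by (simp add: divide_less_eq)
qed

text \<open>
  The exponent \<open>1 - 1/p\<close> is chosen so that the derivative of \<open>B\<close> contains the integrand \<open>A'\<close> as a
  factor: \<open>B' = (1 + p x\<^sup>p) A'\<close>.
\<close>
lemma arcsinh_p_upper:
  assumes p: "p > 0"
  shows "strict_antimono_on {0<..<1}
        (\<lambda>x. arcsinh_p p x / (x * hyp2F1 (- 1 + 1/p) (1/p) (1/p) (- (x powr p))))"
    and "\<And>x. 0 < x \<Longrightarrow> x < 1 \<Longrightarrow>
        arcsinh_p p x < x * hyp2F1 (- 1 + 1/p) (1/p) (1/p) (- (x powr p))"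
proof -
  define A where "A x = x * hyp2F1 (1/p) (1/p) (1 + 1/p) (- (x powr p))" for x
  define B where "B x = x * (1 + x powr p) powr (1 - 1/p)" for x
  define A' where "A' x = (1 + x powr p) powr (- (1/p))" for x
  have A: "arcsinh_p p x = A x" if "0 < x" "x < 1" for x
    using arcsinh_p_eq_hyp2F1[OF p that] by (simp add: A_def)
  have B: "x * hyp2F1 (- 1 + 1/p) (1/p) (1/p) (- (x powr p)) = B x" if "0 < x" "x < 1" for x
    using hyp2F1_cancel[of "1/p" "x powr p" "- 1 + 1/p"] powr_less_one[of x p] that p
    by (simp add: B_def)
  have A'_pos: "A' x > 0" for x
    using powr_ge_zero[of x p] by (simp add: A'_def add_nonneg_eq_0_iff)
  have dA: "(A has_real_derivative A' x) (at x)" if "0 < x" "x < 1" for x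
    using has_derivative_times_hyp2F1[OF p that] by (simp add: A_def[abs_def] A'_def)
  have dB: "(B has_real_derivative (1 + p * x powr p) * A' x) (at x)" if "0 < x" "x < 1" for x
  proof -
    have "1 + (1 - 1/p) * p = p" using p by (simp add: field_simps)
    then show ?thesis
      using DERIV_times_one_plus_powr_powr[OF that(1), of p "1 - 1/p"]
      by (simp add: B_def[abs_def] A'_def)
  qed
  have cA: "continuous_on {0..<1} A" and cB: "continuous_on {0..<1} B"
    using continuous_on_times_hyp2F1[OF p, of "1/p"] continuous_on_times_one_plus_powr_powr[OF p]
    by (simp_all add: A_def[abs_def] B_def[abs_def])
  have zero: "A 0 = 0" "B 0 = 0" by (simp_all add: A_def B_def)
  have "strict_antimono_on {0<..<1} (\<lambda>x. A x / B x)"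
  proof (rule monotone_lhopital[OF cA cB zero dA dB])
    show "0 < (1 + p * t powr p) * A' t" if "0 < t" for t
      using that p A'_pos[of t] by (intro mult_pos_pos add_pos_nonneg) auto
    have "A' x / ((1 + p * x powr p) * A' x) = 1 / (1 + p * x powr p)" for x
      using A'_pos[of x] by simp
    then show "strict_antimono_on {0<..<1} (\<lambda>x. A' x / ((1 + p * x powr p) * A' x))"
      using p by (auto intro!: monotone_onI divide_strict_left_mono powr_less_mono2
          mult_pos_pos add_pos_nonneg)
  qed auto
  then show "strict_antimono_on {0<..<1}
        (\<lambda>x. arcsinh_p p x / (x * hyp2F1 (- 1 + 1/p) (1/p) (1/p) (- (x powr p))))"
    unfolding monotone_on_def by (metis A B greaterThanLessThan_iff)
  fix x :: real assume x: "0 < x" "x < 1"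
  have sub: "{0..x} \<subseteq> {0..<1}" using x by auto
  have "A x - A 0 < B x - B 0"
  proof (rule less_of_deriv_less[OF x(1) continuous_on_subset[OF cA sub]
        continuous_on_subset[OF cB sub] dA dB])
    show "A' t < (1 + p * t powr p) * A' t" if "0 < t" for t
      using that p A'_pos[of t] by simp
  qed (use x in auto)
  then show "arcsinh_p p x < x * hyp2F1 (- 1 + 1/p) (1/p) (1/p) (- (x powr p))"
    unfolding A[OF x] B[OF x] by (simp add: zero)
qed

theorem theorem2:
  shows "(\<forall>p::real. p > 0 \<longrightarrow>
      strict_antimono_on {0<..<1}
        (\<lambda>x. x * hyp2F1 (1/p) (1 + 1/p) (2 + 1/p) (- (x powr p)) / arcsinh_p p x)
    \<and> strict_antimono_on {0<..<1}
        (\<lambda>x. x * hyp2F1 2 (1/p) (2 + 1/p) (- (x powr p)) / arctan_p p x))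
  \<and> (\<forall>p::real. 0 < p \<and> p < 1 \<longrightarrow>
      strict_antimono_on {0<..<1}
        (\<lambda>x. arcsinh_p p x / (x * hyp2F1 (- 1 + 1/p) (1/p) (1/p) (- (x powr p)))))
  \<and> (\<forall>p::real. 0 < p \<and> p < 1 \<longrightarrow> (\<forall>x::real. 0 < x \<and> x < 1 \<longrightarrow>
      x * hyp2F1 (1/p) (1 + 1/p) (2 + 1/p) (- (x powr p)) < arcsinh_p p x
    \<and> arcsinh_p p x < x * hyp2F1 (- 1 + 1/p) (1/p) (1/p) (- (x powr p))))
  \<and> (\<forall>p::real. p > 0 \<longrightarrow> (\<forall>x::real. 0 < x \<and> x < 1 \<longrightarrow>
      x * hyp2F1 (1/p) (1 + 1/p) (2 + 1/p) (- (x powr p)) < arcsinh_p p x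
    \<and> x * hyp2F1 2 (1/p) (2 + 1/p) (- (x powr p)) < arctan_p p x))"
  using arcsinh_p_lower arctan_p_lower arcsinh_p_upper by simp

end
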